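(* Sample $m$ points independently and uniformly from the interval $[0,1]$ and color them red, and, similarly, sample $n$ independent and uniform points from $[0,1]$ and color them blue. Let $\mathcal{M}_{m,n}$ be the length of the shortest balanced interval and $\mathcal{L}_{m,n}$ the length of the longest balanced interval. For $m=o(\sqrt{n})$, $\mathcal{M}_{m,n}$ and $\mathcal{L}_{m,n}$ converge to $0$ almost surely.
   Context: The asymptotics are as $n\to\infty$, with $m$ depending on $n$. A bicoloring of a point set is an assignment of the colors red and blue to its points that uses each color at least once (so $m\geq 1$ and $n\geq 1$). An interval is balanced if the set of sampled points that it contains has the same number of red and blue points. *)

theory Defs
  imports "HOL-Probability.Probability" "HOL-Library.Landau_Symbols"
begin

text \<open>
  A sample of \<open>k\<close> points is a family \<open>x 0, \<dots>, x (k - 1)\<close>, counted by index.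
\<close>
definition points_in :: "(nat \<Rightarrow> real) \<Rightarrow> nat \<Rightarrow> real set \<Rightarrow> nat" where
  "points_in x k I = card {i. i < k \<and> x i \<in> I}"

definition balanced :: "(nat \<Rightarrow> real) \<Rightarrow> nat \<Rightarrow> (nat \<Rightarrow> real) \<Rightarrow> nat \<Rightarrow> real set \<Rightarrow> bool" where
  "balanced r m b n I \<longleftrightarrow> points_in r m I = points_in b n I"

text \<open>
  Intervals may be open, closed or half-open, and lie in \<open>{0..1}\<close>.
\<close>
definition balanced_intervals ::
  "(nat \<Rightarrow> real) \<Rightarrow> nat \<Rightarrow> (nat \<Rightarrow> real) \<Rightarrow> nat \<Rightarrow> real set set" where
  "balanced_intervals r m b n =
     {I. is_interval I \<and> I \<subseteq> {0..1} \<and> balanced r m b n I}"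

text \<open>
  An interval without sampled points is balanced and can be arbitrarily short, so the
  shortest balanced interval is taken among those that contain a sampled point.
  By balance, such an interval contains a red point. One exists if \<open>m \<ge> 1\<close>, \<open>n \<ge> 1\<close> and
  the sampled points are distinct and in \<open>{0..1}\<close>, which holds almost surely for uniform samples.
\<close>
definition shortest_balanced ::
  "(nat \<Rightarrow> real) \<Rightarrow> nat \<Rightarrow> (nat \<Rightarrow> real) \<Rightarrow> nat \<Rightarrow> real" where
  "shortest_balanced r m b n =
     Inf {measure lborel I | I. I \<in> balanced_intervals r m b n \<and> points_in r m I > 0}"

text \<open>
  Here intervals without sampled points are admitted: excluding them can only
  decrease the supremum as long as some balanced interval contains a sampled point.
\<close>
definition longest_balanced ::
  "(nat \<Rightarrow> real) \<Rightarrow> nat \<Rightarrow> (nat \<Rightarrow> real) \<Rightarrow> nat \<Rightarrow> real" where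
  "longest_balanced r m b n = Sup {measure lborel I | I. I \<in> balanced_intervals r m b n}"

end

theory Submission
  imports Defs
begin

text \<open>
  Fix a partition of \<open>{0..1}\<close> into \<open>K\<close> cells. By Hoeffding's inequality and the Borel--Cantelli
  lemma, almost surely each cell eventually contains at least \<open>n / (2 * K)\<close> blue points, which
  exceeds the total number \<open>m n\<close> of red points. An interval of length more than \<open>2 / K\<close> contains
  a cell, so it cannot be balanced. The shortest balanced interval is bounded by the longest one
  because almost surely the points are distinct, and then a closest pair of a red and a blue point
  spans a balanced interval.
\<close>

section \<open>Deterministic bounds on balanced intervals\<close>

lemma points_in_mono: "I \<subseteq> J \<Longrightarrow> points_in x k I \<le> points_in x k J"
  unfolding points_in_def by (rule card_mono) auto

lemma points_in_le: "points_in x k I \<le> k"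
  using card_mono[of "{..<k}" "{i. i < k \<and> x i \<in> I}"] by (auto simp: points_in_def)

lemma points_in_eq_sum_indicator:
  "real (points_in x k I) = (\<Sum>i<k. indicator I (x i))"
proof -
  have "{..<k} \<inter> {i. x i \<in> I} = {i. i < k \<and> x i \<in> I}"
    by auto
  then show ?thesis
    by (simp add: points_in_def indicator_def sum.If_cases of_bool_def)
qed

lemma cell_between:
  fixes K :: nat and x y :: real
  assumes "K > 0" "0 \<le> x" "y \<le> 1" "2 / real K < y - x"
  obtains k where "k < K" "{real k / real K..real (Suc k) / real K} \<subseteq> {x..y}"
proof -
  \<comment> \<open>The first grid point not left of \<open>x\<close>. Rounding up costs less than
    one cell width and the cell itself takes another, which accounts for the gap
    \<open>2 / real K\<close>.\<close>
  define k where "k = nat \<lceil>x * real K\<rceil>"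
  have k: "x * real K \<le> real k" "real k < x * real K + 1"
    using assms unfolding k_def by (simp_all add: of_nat_nat) linarith+
  have "x * real K + 2 < y * real K"
    using assms by (simp add: field_simps)
  moreover have "y * real K \<le> real K"
    using assms by (simp add: mult_le_cancel_right1)
  ultimately have "real k < real K" "real k + 1 \<le> y * real K"
    using k by linarith+
  then have "k < K" "x \<le> real k / real K" "real (Suc k) / real K \<le> y"
    using k assms by (simp_all add: field_simps)
  then show thesis
    by (intro that[of k]) auto
qed

lemma empty_in_balanced_intervals: "{} \<in> balanced_intervals r m b n"
  by (simp add: balanced_intervals_def balanced_def points_in_def is_interval_empty)

lemma measure_interval_le_1:
  assumes "is_interval I" "I \<subseteq> {0..1::real}"
  shows "measure lborel I \<le> 1"
proof -
  have "I \<in> sets borel"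
    using assms by (intro real_interval_borel_measurable)
  then have "measure lborel I \<le> measure lborel {0..1::real}"
    using assms by (intro measure_mono_fmeasurable) (auto simp: fmeasurable_def)
  then show ?thesis by simp
qed

lemma bdd_above_balanced: "bdd_above {measure lborel I | I. I \<in> balanced_intervals r m b n}"
  by (rule bdd_aboveI[of _ 1]) (auto simp: balanced_intervals_def intro: measure_interval_le_1)

lemma longest_balanced_nonneg: "0 \<le> longest_balanced r m b n"
  unfolding longest_balanced_def
  by (rule cSup_upper2[of "measure lborel {}"])
    (use empty_in_balanced_intervals bdd_above_balanced in \<open>auto intro!: exI[of _ "{}"]\<close>)

text \<open>A balanced interval has at most \<open>m\<close> blue points, since it has at most
  \<open>m\<close> red ones, so it cannot contain a cell. By \<open>cell_between\<close>, this
  limits its diameter.\<close>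

lemma longest_balanced_le:
  assumes K: "K > 0"
    and cells: "\<And>k. k < K \<Longrightarrow> points_in b n {real k / real K..real (Suc k) / real K} > m"
  shows "longest_balanced r m b n \<le> 2 / real K"
  unfolding longest_balanced_def
proof (rule cSup_least)
  show "{measure lborel I | I. I \<in> balanced_intervals r m b n} \<noteq> {}"
    using empty_in_balanced_intervals by blast
next
  fix l assume "l \<in> {measure lborel I | I. I \<in> balanced_intervals r m b n}"
  then obtain I where l: "l = measure lborel I" and I: "is_interval I" "I \<subseteq> {0..1}"
    and bal: "points_in r m I = points_in b n I"
    by (auto simp: balanced_intervals_def balanced_def)
  have diam: "y - x \<le> 2 / real K" if "x \<in> I" "y \<in> I" for x y
  proof (rule ccontr)
    assume "\<not> y - x \<le> 2 / real K"
    then have gap: "2 / real K < y - x" by simp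
    have "0 \<le> x" "y \<le> 1"
      using subsetD[OF I(2) that(1)] subsetD[OF I(2) that(2)] by simp_all
    from this gap obtain k where k: "k < K" "{real k / real K..real (Suc k) / real K} \<subseteq> {x..y}"
      by (rule cell_between[OF K])
    have "{x..y} \<subseteq> I"
      using mem_is_interval_1_I[OF I(1) that] by auto
    then have "points_in b n {real k / real K..real (Suc k) / real K} \<le> points_in r m I"
      unfolding bal using k(2) by (intro points_in_mono) auto
    also have "\<dots> \<le> m" by (rule points_in_le)
    finally show False using cells[OF k(1)] by simp
  qed
  show "l \<le> 2 / real K"
  proof (cases "I = {}")
    case False
    \<comment> \<open>\<open>I\<close> may be open on the left, so \<open>Inf I\<close>, which need
      not belong to \<open>I\<close>, serves as its left endpoint.\<close>
    have "I \<subseteq> {Inf I..Inf I + 2 / real K}"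
    proof
      fix y assume y: "y \<in> I"
      have "bdd_below I"
        using I(2) by (auto intro!: bdd_belowI[of _ 0])
      moreover have "y - 2 / real K \<le> Inf I"
        using diam[OF _ y] False by (intro cInf_greatest) (auto simp: algebra_simps)
      ultimately show "y \<in> {Inf I..Inf I + 2 / real K}"
        using cInf_lower[OF y] by auto
    qed
    then have "measure lborel I \<le> measure lborel {Inf I..Inf I + 2 / real K}"
      using real_interval_borel_measurable[OF I(1)] by (intro measure_mono_fmeasurable) (auto simp: fmeasurable_def)
    then show ?thesis by (simp add: l)
  qed (simp add: l)
qed

text \<open>Take the closed interval spanned by a red and a blue point at minimal distance: a
  further red point in it would be closer to the blue end, and a further blue point closer to the
  red end. The result keeps the infimum in \<open>shortest_balanced\<close> from ranging over the
  empty set, where its value is unspecified.\<close>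

lemma closest_pair_balanced:
  fixes r b :: "nat \<Rightarrow> real"
  assumes "m \<ge> 1" "n \<ge> 1"
    and unit: "\<And>i. i < m \<Longrightarrow> r i \<in> {0..1}" "\<And>j. j < n \<Longrightarrow> b j \<in> {0..1}"
    and dist: "inj_on r {..<m}" "inj_on b {..<n}" "r ` {..<m} \<inter> b ` {..<n} = {}"
  obtains I where "I \<in> balanced_intervals r m b n" "points_in r m I > 0"
proof -
  let ?d = "\<lambda>(i, j). \<bar>r i - b j\<bar>"
  let ?S = "{..<m} \<times> {..<n}"
  have "(0, 0) \<in> ?S" using assms by auto
  then have "?S \<noteq> {}" by blast
  then have "arg_min_on ?d ?S \<in> ?S" and least: "\<And>z. z \<in> ?S \<Longrightarrow> ?d (arg_min_on ?d ?S) \<le> ?d z"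
    by (intro arg_min_if_finite arg_min_least; simp)+
  then obtain i j where "arg_min_on ?d ?S = (i, j)" and ij: "i < m" "j < n"
    by blast
  then have min: "\<bar>r i - b j\<bar> \<le> \<bar>r i' - b j'\<bar>" if "i' < m" "j' < n" for i' j'
    using least[of "(i', j')"] that by simp
  define I where "I = {min (r i) (b j)..max (r i) (b j)}"
  \<comment> \<open>Membership as equality in the triangle inequality avoids cases on the order of
    the endpoints: with minimality, linear arithmetic forces a point of \<open>I\<close> onto the
    endpoint of its own color.\<close>
  have I: "x \<in> I \<longleftrightarrow> \<bar>x - r i\<bar> + \<bar>x - b j\<bar> = \<bar>r i - b j\<bar>" for x
    by (auto simp: I_def min_def max_def)
  have neq: "r i' \<noteq> b j'" if "i' < m" "j' < n" for i' j'
    using dist(3) that by blast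
  have "r i' \<in> I \<longleftrightarrow> i' = i" if "i' < m" for i'
  proof
    assume "r i' \<in> I"
    then have "r i' = r i" using min[OF \<open>i' < m\<close> ij(2)] unfolding I by linarith
    then show "i' = i" using dist(1) ij(1) that by (auto dest: inj_onD)
  qed (simp add: I)
  then have red: "{i'. i' < m \<and> r i' \<in> I} = {i}" using ij(1) by auto
  have "b j' \<in> I \<longleftrightarrow> j' = j" if "j' < n" for j'
  proof
    assume "b j' \<in> I"
    then have "b j' = b j" using min[OF ij(1) \<open>j' < n\<close>] unfolding I by linarith
    then show "j' = j" using dist(2) ij(2) that by (auto dest: inj_onD)
  qed (simp add: I)
  then have blue: "{j'. j' < n \<and> b j' \<in> I} = {j}" using ij(2) by auto
  show thesis
  proof
    show "I \<in> balanced_intervals r m b n"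
      using red blue unit(1)[OF ij(1)] unit(2)[OF ij(2)]
      by (auto simp: balanced_intervals_def balanced_def points_in_def I_def is_interval_cc)
    show "points_in r m I > 0"
      using red by (simp add: points_in_def)
  qed
qed

text \<open>The length of the witness \<open>I\<close> lies between the infimum and the
  supremum.\<close>

lemma shortest_balanced_bounds:
  assumes "I \<in> balanced_intervals r m b n" "points_in r m I > 0"
  shows "0 \<le> shortest_balanced r m b n" "shortest_balanced r m b n \<le> longest_balanced r m b n"
proof -
  let ?S = "{measure lborel I | I. I \<in> balanced_intervals r m b n \<and> points_in r m I > 0}"
  have mem: "measure lborel I \<in> ?S" using assms by blast
  show "0 \<le> shortest_balanced r m b n"
    unfolding shortest_balanced_def by (rule cInf_greatest) (use mem in auto)
  have "shortest_balanced r m b n \<le> measure lborel I"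
    unfolding shortest_balanced_def by (rule cInf_lower[OF mem]) (auto intro!: bdd_belowI[of _ 0])
  also have "\<dots> \<le> longest_balanced r m b n"
    unfolding longest_balanced_def by (rule cSup_upper[OF _ bdd_above_balanced]) (use assms in auto)
  finally show "shortest_balanced r m b n \<le> longest_balanced r m b n" .
qed

section \<open>Independence and uniform random variables\<close>

context prob_space
begin

text \<open>Restrictions of the family to the disjoint blocks \<open>{a}\<close> and
  \<open>{b}\<close> are independent; evaluating each at its only index recovers the
  variables.\<close>

lemma indep_vars_pair:
  assumes "indep_vars N X I" "a \<in> I" "b \<in> I" "a \<noteq> b"
  shows "indep_var (N a) (X a) (N b) (X b)"
proof -
  have "indep_var (PiM {a} N) (\<lambda>\<omega>. restrict (\<lambda>i. X i \<omega>) {a}) (PiM {b} N) (\<lambda>\<omega>. restrict (\<lambda>i. X i \<omega>) {b})"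
    using assms by (intro indep_var_restrict) auto
  then have "indep_var (N a) ((\<lambda>f. f a) \<circ> (\<lambda>\<omega>. restrict (\<lambda>i. X i \<omega>) {a}))
      (N b) ((\<lambda>f. f b) \<circ> (\<lambda>\<omega>. restrict (\<lambda>i. X i \<omega>) {b}))"
    by (rule indep_var_compose) auto
  then show ?thesis by (simp add: comp_def)
qed

text \<open>Injectivity makes the blocks \<open>{f j}\<close> disjoint, so grouping by them
  preserves independence. With \<open>f = Inr\<close> this extracts the blue sample from the joint
  family.\<close>

lemma indep_vars_reindex_inj:
  assumes "indep_vars N X (f ` L)" "inj_on f L"
  shows "indep_vars (\<lambda>j. N (f j)) (\<lambda>j. X (f j)) L"
proof -
  have "indep_vars (\<lambda>j. PiM {f j} N) (\<lambda>j \<omega>. restrict (\<lambda>i. X i \<omega>) {f j}) L"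
    using assms by (intro indep_vars_restrict) (auto simp: disjoint_family_on_def inj_on_def)
  then have "indep_vars (\<lambda>j. N (f j)) (\<lambda>j \<omega>. restrict (\<lambda>i. X i \<omega>) {f j} (f j)) L"
    by (rule indep_vars_compose2) auto
  then show ?thesis by simp
qed

text \<open>By independence the joint law is a product, and by Fubini the diagonal is null because
  each of its sections is a singleton, null for the law of \<open>Y\<close>.\<close>

lemma AE_indep_neq:
  fixes X Y :: "'a \<Rightarrow> real"
  assumes ind: "indep_var borel X borel Y"
    and atomless: "\<And>x. emeasure (distr M borel Y) {x} = 0"
  shows "AE \<omega> in M. X \<omega> \<noteq> Y \<omega>"
proof -
  have [measurable]: "X \<in> borel_measurable M" "Y \<in> borel_measurable M"
    using ind by (auto dest: indep_var_rv1 indep_var_rv2)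
  interpret X: prob_space "distr M borel X" by (rule prob_space_distr) simp
  interpret Y: prob_space "distr M borel Y" by (rule prob_space_distr) simp
  interpret XY: pair_sigma_finite "distr M borel X" "distr M borel Y" ..
  have pred_neq: "Measurable.pred (borel \<Otimes>\<^sub>M borel) (\<lambda>z :: real \<times> real. fst z \<noteq> snd z)"
    by measurable
  have "AE y in distr M borel Y. x \<noteq> y" for x
    by (rule AE_I[of _ _ "{x}"]) (use atomless in auto)
  then have "AE z in distr M borel X \<Otimes>\<^sub>M distr M borel Y. fst z \<noteq> snd z"
    using pred_neq by (subst XY.AE_pair_iff[symmetric]) (simp_all add: pred_def space_pair_measure)
  also have "distr M borel X \<Otimes>\<^sub>M distr M borel Y = distr M (borel \<Otimes>\<^sub>M borel) (\<lambda>\<omega>. (X \<omega>, Y \<omega>))"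
    using ind by (simp add: indep_var_distribution_eq)
  finally show ?thesis
    by (subst (asm) AE_distr_iff) auto
qed

lemma AE_inj_on_indep_vars:
  fixes X :: "'i \<Rightarrow> 'a \<Rightarrow> real"
  assumes "finite I" "indep_vars (\<lambda>_. borel) X I"
    and atomless: "\<And>i x. i \<in> I \<Longrightarrow> emeasure (distr M borel (X i)) {x} = 0"
  shows "AE \<omega> in M. inj_on (\<lambda>i. X i \<omega>) I"
proof -
  have "AE \<omega> in M. i \<noteq> j \<longrightarrow> X i \<omega> \<noteq> X j \<omega>" if "i \<in> I" "j \<in> I" for i j
    using AE_indep_neq[OF indep_vars_pair[OF assms(2) that] atomless[OF that(2)]]
    by (cases "i = j") auto
  then have "AE \<omega> in M. \<forall>i\<in>I. \<forall>j\<in>I. i \<noteq> j \<longrightarrow> X i \<omega> \<noteq> X j \<omega>"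
    using assms(1) by (simp add: AE_finite_all)
  then show ?thesis by eventually_elim (auto simp: inj_on_def)
qed

lemma uniform_distr_unit:
  fixes X :: "'a \<Rightarrow> real"
  assumes [measurable]: "X \<in> borel_measurable M"
    and unif: "distr M lborel X = uniform_measure lborel {0..1}"
  shows "A \<in> sets borel \<Longrightarrow> emeasure (distr M borel X) A = emeasure lborel ({0..1} \<inter> A)"
    and "A \<in> sets borel \<Longrightarrow> prob (X -` A \<inter> space M) = measure lborel ({0..1} \<inter> A)"
    and "AE \<omega> in M. X \<omega> \<in> {0..1}"
proof -
  \<comment> \<open>\<open>borel\<close> and \<open>lborel\<close> have the same measurable sets,
    and the push-forward depends on its target only through these.\<close>
  have "distr M borel X = distr M lborel X"
    by (rule distr_cong) auto
  then have eq: "distr M borel X = uniform_measure lborel {0..1}"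
    using unif by simp
  then show em: "emeasure (distr M borel X) A = emeasure lborel ({0..1} \<inter> A)" if "A \<in> sets borel" for A
    using that by (simp add: divide_ennreal_def)
  show "prob (X -` A \<inter> space M) = measure lborel ({0..1} \<inter> A)" if "A \<in> sets borel" for A
    using em[OF that] that by (simp add: emeasure_distr measure_def)
  have "AE x in distr M borel X. x \<in> {0..1}"
    unfolding eq by (rule AE_uniform_measureI) auto
  then show "AE \<omega> in M. X \<omega> \<in> {0..1}"
    by (subst (asm) AE_distr_iff) auto
qed

section \<open>Concentration of the number of points in a set\<close>

text \<open>Hoeffding's inequality for a deviation of half the mean \<open>n * p\<close>. The bound
  is written as an \<open>n\<close>-th power so that it can be summed as a geometric series.\<close>

lemma prob_few_points_le:
  fixes X :: "nat \<Rightarrow> 'a \<Rightarrow> real"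
  assumes ind: "indep_vars (\<lambda>_. borel) X {..<n}" and "n \<ge> 1"
    and [measurable]: "A \<in> sets borel"
    and p: "\<And>j. j < n \<Longrightarrow> prob (X j -` A \<inter> space M) = p" and "p \<ge> 0"
  shows "prob {\<omega>\<in>space M. real (points_in (\<lambda>j. X j \<omega>) n A) \<le> real n * p / 2}
           \<le> exp (- (p\<^sup>2 / 2)) ^ n"
proof -
  have [measurable]: "X j \<in> borel_measurable M" if "j < n" for j
    using ind that by (auto simp: indep_vars_def)
  \<comment> \<open>Each indicator ranges over an interval of length 1, so the sum of squared ranges
    in Hoeffding's exponent is \<open>n\<close>.\<close>
  interpret Hoeffding_ineq M "{..<n}" "\<lambda>j \<omega>. indicator A (X j \<omega>)" "\<lambda>_. 0" "\<lambda>_. 1"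
    "\<Sum>j<n. expectation (\<lambda>\<omega>. indicator A (X j \<omega>))"
    by unfold_locales
      (auto intro!: indep_vars_compose2[OF ind] split: split_indicator)
  have "expectation (\<lambda>\<omega>. indicator A (X j \<omega>) :: real) = p" if "j < n" for j
  proof -
    have "expectation (\<lambda>\<omega>. indicator A (X j \<omega>) :: real) = expectation (indicator (X j -` A \<inter> space M))"
      by (intro Bochner_Integration.integral_cong) (auto split: split_indicator)
    then show ?thesis using that p by simp
  qed
  then have "(\<Sum>j<n. expectation (\<lambda>\<omega>. indicator A (X j \<omega>) :: real)) = real n * p"
    by simp
  then have "prob {\<omega>\<in>space M. (\<Sum>j<n. indicator A (X j \<omega>)) \<le> real n * p - real n * p / 2}
      \<le> exp (- 2 * (real n * p / 2)\<^sup>2 / real n)"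
    using Hoeffding_ineq_le[of "real n * p / 2"] \<open>n \<ge> 1\<close> \<open>p \<ge> 0\<close> by simp
  also have "- 2 * (real n * p / 2)\<^sup>2 / real n = real n * - (p\<^sup>2 / 2)"
    using \<open>n \<ge> 1\<close> by (simp add: power2_eq_square field_simps)
  also have "exp (real n * - (p\<^sup>2 / 2)) = exp (- (p\<^sup>2 / 2)) ^ n"
    by (rule exp_of_nat_mult)
  finally show ?thesis
    by (simp add: points_in_eq_sum_indicator mult.commute)
qed

text \<open>The first Borel--Cantelli lemma asks only for summable probabilities, so independence is
  required within each row \<open>X n\<close> and the joint law of different rows is
  arbitrary.\<close>

lemma AE_eventually_many_points:
  fixes X :: "nat \<Rightarrow> nat \<Rightarrow> 'a \<Rightarrow> real"
  assumes ind: "\<And>n. n \<ge> 1 \<Longrightarrow> indep_vars (\<lambda>_. borel) (X n) {..<n}"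
    and [measurable]: "A \<in> sets borel"
    and p: "\<And>n j. n \<ge> 1 \<Longrightarrow> j < n \<Longrightarrow> prob (X n j -` A \<inter> space M) = p" and "p > 0"
  shows "AE \<omega> in M. \<forall>\<^sub>F n in sequentially. real n * p / 2 < real (points_in (\<lambda>j. X n j \<omega>) n A)"
proof -
  define F where "F n = {\<omega>\<in>space M. real (points_in (\<lambda>j. X n j \<omega>) n A) \<le> real n * p / 2}" for n
  have meas: "X n j \<in> borel_measurable M" if "j < n" for n j
    using ind[of n] that by (auto simp: indep_vars_def)
  have "F n \<in> events" for n
  proof -
    have [measurable]: "j \<in> {..<n} \<Longrightarrow> X n j \<in> borel_measurable M" for j
      using meas by simp
    show ?thesis
      unfolding F_def points_in_eq_sum_indicator by measurable
  qed
  moreover have "summable (\<lambda>n. prob (F n))"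
  proof (rule summable_comparison_test')
    \<comment> \<open>Since \<open>p > 0\<close>, the ratio is below 1.\<close>
    show "summable (\<lambda>n. exp (- (p\<^sup>2 / 2)) ^ n)"
      using \<open>p > 0\<close> by (intro summable_geometric) simp
    show "norm (prob (F n)) \<le> exp (- (p\<^sup>2 / 2)) ^ n" if "n \<ge> 1" for n
      using prob_few_points_le[OF ind[OF that] that _ p[OF that]] \<open>p > 0\<close> by (simp add: F_def)
  qed
  ultimately have "AE \<omega> in M. \<forall>\<^sub>F n in sequentially. \<omega> \<in> space M - F n"
    by (intro borel_cantelli_AE1) (auto simp: emeasure_eq_measure)
  then show ?thesis
    by eventually_elim (auto simp: F_def not_le elim: eventually_mono)
qed

end

section \<open>Almost sure convergence for the two samples\<close>

theorem theorem7:
  fixes P :: "'w measure"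
    and m :: "nat \<Rightarrow> nat"
    and R B :: "nat \<Rightarrow> nat \<Rightarrow> 'w \<Rightarrow> real"
  assumes "prob_space P"
    and "\<And>n. n \<ge> 1 \<Longrightarrow> m n \<ge> 1"
    and "(\<lambda>n. real (m n)) \<in> o(\<lambda>n. sqrt (real n))"
    and "\<And>n. n \<ge> 1 \<Longrightarrow> prob_space.indep_vars P (\<lambda>_. borel)
           (case_sum (R n) (B n)) ({..<m n} <+> {..<n})"
    and "\<And>n i. n \<ge> 1 \<Longrightarrow> i < m n \<Longrightarrow> distr P lborel (R n i) = uniform_measure lborel {0..1}"
    and "\<And>n j. n \<ge> 1 \<Longrightarrow> j < n \<Longrightarrow> distr P lborel (B n j) = uniform_measure lborel {0..1}"
  shows "AE \<omega> in P.
           (\<lambda>n. shortest_balanced (\<lambda>i. R n i \<omega>) (m n) (\<lambda>j. B n j \<omega>) n) \<longlonglongrightarrow> 0 \<and>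
           (\<lambda>n. longest_balanced (\<lambda>i. R n i \<omega>) (m n) (\<lambda>j. B n j \<omega>) n) \<longlonglongrightarrow> 0"
proof -
  interpret prob_space P by fact
  \<comment> \<open>\<open>Inl\<close> indexes red and \<open>Inr\<close> blue points, so
    injectivity on \<open>?I n\<close> covers distinctness within each color and between the
    colors.\<close>
  let ?X = "\<lambda>n. case_sum (R n) (B n)"
  let ?I = "\<lambda>n. {..<m n} <+> {..<n}"
  note ind = assms(4)
  have meas: "?X n a \<in> borel_measurable P" if "n \<ge> 1" "a \<in> ?I n" for n a
    using ind[OF that(1)] that(2) unfolding indep_vars_def by blast
  have unif: "distr P lborel (?X n a) = uniform_measure lborel {0..1}" if "n \<ge> 1" "a \<in> ?I n" for n a
    using that assms(5,6) by (auto elim!: PlusE)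
  note U = uniform_distr_unit[OF meas unif]

  have points: "AE \<omega> in P. \<forall>n\<ge>1. inj_on (\<lambda>a. ?X n a \<omega>) (?I n) \<and> (\<forall>a\<in>?I n. ?X n a \<omega> \<in> {0..1})"
  proof -
    have "AE \<omega> in P. inj_on (\<lambda>a. ?X n a \<omega>) (?I n) \<and> (\<forall>a\<in>?I n. ?X n a \<omega> \<in> {0..1})"
      if n: "n \<ge> 1" for n
    proof -
      have "emeasure (distr P borel (?X n a)) {x} = 0" if "a \<in> ?I n" for a x
        using U(1)[OF n that n that, of "{x}"] emeasure_mono[of "{0..1} \<inter> {x}" "{x}" lborel]
        by simp
      then have "AE \<omega> in P. inj_on (\<lambda>a. ?X n a \<omega>) (?I n)"
        by (intro AE_inj_on_indep_vars ind n finite_Plus) auto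
      moreover have "AE \<omega> in P. \<forall>a\<in>?I n. ?X n a \<omega> \<in> {0..1}"
        using U(3)[OF n _ n] by (simp only: AE_finite_all finite_Plus finite_lessThan) blast
      ultimately show ?thesis by eventually_elim auto
    qed
    then show ?thesis by (simp add: AE_all_countable)
  qed

  \<comment> \<open>\<open>K\<close> is chosen later from the error bound with
    \<open>\<omega>\<close> already fixed, so the null set must not depend on it. There are only
    countably many pairs of \<open>K\<close> and \<open>k\<close>.\<close>
  have cells: "AE \<omega> in P. \<forall>K\<ge>1. \<forall>k<K. \<forall>\<^sub>F n in sequentially.
      real n * (1 / real K) / 2 < real (points_in (\<lambda>j. B n j \<omega>) n {real k / real K..real (Suc k) / real K})"
  proof -
    have "AE \<omega> in P. \<forall>\<^sub>F n in sequentially.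
        real n * (1 / real K) / 2 < real (points_in (\<lambda>j. B n j \<omega>) n {real k / real K..real (Suc k) / real K})"
      if "K \<ge> 1" "k < K" for K k :: nat
    proof (rule AE_eventually_many_points)
      let ?A = "{real k / real K..real (Suc k) / real K}"
      show "indep_vars (\<lambda>_. borel) (B n) {..<n}" if "n \<ge> 1" for n
      proof -
        have "indep_vars (\<lambda>_. borel) (?X n) (Inr ` {..<n})"
          by (rule indep_vars_subset[OF ind[OF that]]) auto
        then show ?thesis
          by (auto dest!: indep_vars_reindex_inj)
      qed
      \<comment> \<open>Cells with \<open>k < K\<close> lie inside the unit interval, so the
        probability of a cell is its full length.\<close>
      have "real (Suc k) / real K \<le> 1"
        using that by simp
      then have sub: "{0..1} \<inter> ?A = ?A"
        by auto
      have "measure lborel ?A = real (Suc k) / real K - real k / real K"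
        by (rule measure_lborel_Icc) (simp add: divide_right_mono)
      then have len: "measure lborel ?A = 1 / real K"
        by (simp flip: diff_divide_distrib)
      show "prob (B n j -` ?A \<inter> space P) = 1 / real K" if "n \<ge> 1" "j < n" for n j
      proof -
        have "Inr j \<in> ?I n" using that by auto
        from U(2)[OF that(1) this that(1) this, of ?A] show ?thesis
          unfolding sub len by simp
      qed
    qed (use that in auto)
    then show ?thesis by (simp add: AE_all_countable)
  qed

  \<comment> \<open>The little-o bound is applied with the constant \<open>1 / (2 * real K)\<close>,
    and \<open>sqrt n \<le> n\<close> then brings it to the blue count guaranteed in every
    cell.\<close>
  have few_red: "\<forall>\<^sub>F n in sequentially. real (m n) \<le> real n * (1 / real K) / 2" if "K \<ge> 1" for K :: nat
  proof -
    have "\<forall>\<^sub>F n in sequentially. norm (real (m n)) \<le> 1 / (2 * real K) * norm (sqrt (real n))"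
      using that by (intro landau_o.smallD[OF assms(3)]) simp
    then show ?thesis
    proof eventually_elim
      case (elim n)
      have "sqrt (real n) \<le> real n"
        by (rule real_le_lsqrt) (auto simp: power2_eq_square simp flip: of_nat_mult)
      then have "1 / (2 * real K) * sqrt (real n) \<le> 1 / (2 * real K) * real n"
        by (intro mult_left_mono) auto
      with elim show ?case by (simp add: field_simps)
    qed
  qed

  from points cells show ?thesis
  proof eventually_elim
    case (elim \<omega>)
    let ?S = "\<lambda>n. shortest_balanced (\<lambda>i. R n i \<omega>) (m n) (\<lambda>j. B n j \<omega>) n"
    let ?L = "\<lambda>n. longest_balanced (\<lambda>i. R n i \<omega>) (m n) (\<lambda>j. B n j \<omega>) n"
    have L: "?L \<longlonglongrightarrow> 0"
    proof (rule tendstoI)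
      fix e :: real assume "e > 0"
      then obtain K0 :: nat where "2 / e < real K0" using reals_Archimedean2 by blast
      \<comment> \<open>The successor makes \<open>K\<close> positive and preserves
        \<open>2 / e < K\<close>.\<close>
      define K where "K = Suc K0"
      have K: "K \<ge> 1" "2 / real K < e"
        using \<open>2 / e < real K0\<close> \<open>e > 0\<close> by (simp_all add: K_def field_simps)
      \<comment> \<open>Each cell has its own threshold for \<open>n\<close>; as there are finitely
        many cells, a common one exists.\<close>
      have "\<forall>\<^sub>F n in sequentially. \<forall>k\<in>{..<K}. real n * (1 / real K) / 2
          < real (points_in (\<lambda>j. B n j \<omega>) n {real k / real K..real (Suc k) / real K})"
        using elim(2) K(1) by (intro eventually_ball_finite) auto
      with few_red[OF K(1)] show "\<forall>\<^sub>F n in sequentially. dist (?L n) 0 < e"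
      proof eventually_elim
        case (elim n)
        have "?L n \<le> 2 / real K"
        proof (rule longest_balanced_le)
          fix k assume "k < K"
          then have "real (m n) < real (points_in (\<lambda>j. B n j \<omega>) n {real k / real K..real (Suc k) / real K})"
            using elim by (meson lessThan_iff order.strict_trans1)
          then show "m n < points_in (\<lambda>j. B n j \<omega>) n {real k / real K..real (Suc k) / real K}"
            by (simp only: of_nat_less_iff)
        qed (use K in simp)
        with K(2) show ?case
          using longest_balanced_nonneg[of "\<lambda>i. R n i \<omega>" "m n" "\<lambda>j. B n j \<omega>" n] by simp
      qed
    qed
    \<comment> \<open>For \<open>n = 0\<close> there is no blue point, hence no balanced interval
      containing a red one, and the infimum is unspecified. The squeeze needs the bounds only
      eventually.\<close>
    have bounds: "0 \<le> ?S n \<and> ?S n \<le> ?L n" if n: "n \<ge> 1" for n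
    proof -
      have inj: "inj_on (\<lambda>a. ?X n a \<omega>) (?I n)" and unit: "\<And>a. a \<in> ?I n \<Longrightarrow> ?X n a \<omega> \<in> {0..1}"
        using elim(1) n by blast+
      have "R n i \<omega> \<noteq> B n j \<omega>" if "i < m n" "j < n" for i j
        using inj_onD[OF inj, of "Inl i" "Inr j"] that by auto
      moreover have "inj_on (\<lambda>i. R n i \<omega>) {..<m n}"
        by (rule inj_onI) (use inj_onD[OF inj, of "Inl _" "Inl _"] in auto)
      moreover have "inj_on (\<lambda>j. B n j \<omega>) {..<n}"
        by (rule inj_onI) (use inj_onD[OF inj, of "Inr _" "Inr _"] in auto)
      moreover have "R n i \<omega> \<in> {0..1}" if "i < m n" for i
        using unit[of "Inl i"] that by auto
      moreover have "B n j \<omega> \<in> {0..1}" if "j < n" for j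
        using unit[of "Inr j"] that by auto
      ultimately obtain I where
        "I \<in> balanced_intervals (\<lambda>i. R n i \<omega>) (m n) (\<lambda>j. B n j \<omega>) n" "points_in (\<lambda>i. R n i \<omega>) (m n) I > 0"
        using closest_pair_balanced[of "m n" n "\<lambda>i. R n i \<omega>" "\<lambda>j. B n j \<omega>"] assms(2) n by blast
      then show ?thesis
        using shortest_balanced_bounds by blast
    qed
    have "?S \<longlonglongrightarrow> 0"
      by (rule tendsto_sandwich[OF _ _ tendsto_const L])
        (use bounds in \<open>auto intro!: eventually_sequentiallyI[of 1]\<close>)
    with L show ?case by simp
  qed
qed

end
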